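(* Let $W$, $\rho$, $\gamma$, $p$, $L$ be as described in the context and let $H:[0,1]\to[0,1]$ be the homeomorphism with $W=H\circ L\circ H^{-1}$ described there. Let $\square=[0,1]\times[0,1]$, let $W_0=W|_{[0,\rho]}$, let $W_1:[\rho,1]\to[0,1]$ be the continuous extension of $W|_{(\rho,1]}$ to $[\rho,1]$, and let $$P=\{(x,y)\in\square:x\le p/\gamma,\ y\le W_0(\rho)\},\qquad Q=\{(x,y)\in\square:x\ge p/\gamma+1-1/\gamma,\ y\ge W_1(\rho)\},$$ $$F_0(x,y)=(\gamma x,\,W_0^{-1}(y))\ \text{ for }(x,y)\in P,\qquad F_1(x,y)=(\gamma x+1-\gamma,\,W_1^{-1}(y))\ \text{ for }(x,y)\in Q.$$ For compact $S\subseteq\square$ put $r(S)=F_0(S\cap P)\cup F_1(S\cap Q)$. Then the graph $gr(H)=\{(x,H(x)):x\in[0,1]\}$ satisfies $$gr(H)=\bigcap_{k\in\mathbb N}r^k(\square)=\lim_{k\to\infty}r^k(\square),$$ where the limit is with respect to the Hausdorff metric on the nonempty compact subsets of $\square$.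
   Context: $\mathbb N=\{0,1,2,\dots\}$. Let $0<\lambda<1$, $\rho\in(0,1)$, and let $W:[0,1]\to[0,1]$ satisfy $W(0)=0$, $W(1)=1$, and be differentiable on both $[0,\rho]$ and $(\rho,1]$ with slope greater than $1/\lambda>1$. For $x\in[0,1]$ the itinerary $\tau(x)\in\{0,1\}^{\mathbb N}$ is given by $\tau(x)_k=0$ if $W^k(x)\in[0,\rho]$ and $\tau(x)_k=1$ if $W^k(x)\in(\rho,1]$; $\tau(\rho+)=\lim_{\varepsilon\to0^+}\tau(\rho+\varepsilon)$ in the product topology. For a sequence $\sigma\in\{0,1\}^{\mathbb N}$ and $|\zeta|<1$ write $\sigma(\zeta)=(1-\zeta)\sum_{k\ge0}\sigma_k\zeta^k$. The number $\gamma\in(0,1)$ is the unique solution of $\tau(\rho)(\gamma)=\tau(\rho+)(\gamma)$ with $\tau(\rho)(\varsigma)<\tau(\rho+)(\varsigma)$ for all $\varsigma\in[0.5,\gamma)$, and $p=\tau(\rho)(\gamma)$. The map $L:[0,1]\to[0,1]$ is $L(x)=x/\gamma$ for $x\in[0,p]$ and $L(x)=x/\gamma+1-1/\gamma$ for $x\in(p,1]$. $H$ is the homeomorphism of $[0,1]$ with $W=H\circ L\circ H^{-1}$ whose inverse is $x\mapsto\tau(x)(\gamma)$ for $x\in[0,1)$, $1\mapsto1$ (the existence of $\gamma$ and of this conjugacy is an earlier result of the paper). *)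

theory Defs
  imports "HOL-Analysis.Analysis"
begin

text \<open>
  Binary sequences are functions \<^typ>\<open>nat \<Rightarrow> real\<close> with values 0 and 1.  These
  form a closed subset of \<^typ>\<open>nat \<Rightarrow> real\<close>, on which the product topology of that type induces the
  product of discrete topologies.  (The values are real because \<^typ>\<open>nat \<Rightarrow> nat\<close> is no instance of
  \<^class>\<open>t2_space\<close>, which \<^const>\<open>Lim\<close> requires.)
\<close>

definition itinerary :: "(real \<Rightarrow> real) \<Rightarrow> real \<Rightarrow> real \<Rightarrow> nat \<Rightarrow> real" where
  "itinerary W \<rho> x = (\<lambda>k. if (W ^^ k) x \<in> {0..\<rho>} then 0 else 1)"

definition right_itinerary :: "(real \<Rightarrow> real) \<Rightarrow> real \<Rightarrow> nat \<Rightarrow> real" where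
  "right_itinerary W \<rho> = Lim (at_right \<rho>) (itinerary W \<rho>)"

definition seq_val :: "(nat \<Rightarrow> real) \<Rightarrow> real \<Rightarrow> real" where
  "seq_val \<sigma> \<zeta> = (1 - \<zeta>) * (\<Sum>k. \<sigma> k * \<zeta> ^ k)"

text \<open>
  The last conjunct makes \<open>\<gamma>\<close> unique: if two numbers \<open>\<gamma> < \<gamma>'\<close> satisfied all conditions, then either
  \<open>\<gamma> \<ge> 1/2\<close>, against the strict inequality for \<open>\<gamma>'\<close> at \<open>\<gamma>\<close>, or \<open>\<gamma> < 1/2\<close>, where the two values cannot
  agree because the sequences start with 0 and 1 respectively.
\<close>

definition is_critical_param :: "(real \<Rightarrow> real) \<Rightarrow> real \<Rightarrow> real \<Rightarrow> bool" where
  "is_critical_param W \<rho> \<gamma> \<longleftrightarrow>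
     0 < \<gamma> \<and> \<gamma> < 1 \<and>
     seq_val (itinerary W \<rho> \<rho>) \<gamma> = seq_val (right_itinerary W \<rho>) \<gamma> \<and>
     (\<forall>\<zeta>\<in>{1/2..<\<gamma>}. seq_val (itinerary W \<rho> \<rho>) \<zeta> < seq_val (right_itinerary W \<rho>) \<zeta>)"

definition lin_map :: "real \<Rightarrow> real \<Rightarrow> real \<Rightarrow> real" where
  "lin_map \<gamma> p x = (if x \<le> p then x / \<gamma> else x / \<gamma> + 1 - 1 / \<gamma>)"

definition conj_inv :: "(real \<Rightarrow> real) \<Rightarrow> real \<Rightarrow> real \<Rightarrow> real \<Rightarrow> real" where
  "conj_inv W \<rho> \<gamma> x = (if x = 1 then 1 else seq_val (itinerary W \<rho> x) \<gamma>)"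

definition right_branch :: "(real \<Rightarrow> real) \<Rightarrow> real \<Rightarrow> real \<Rightarrow> real" where
  "right_branch W \<rho> x = (if x = \<rho> then Lim (at_right \<rho>) W else W x)"

definition unit_square :: "(real \<times> real) set" where
  "unit_square = {0..1} \<times> {0..1}"

definition dom_P :: "(real \<Rightarrow> real) \<Rightarrow> real \<Rightarrow> real \<Rightarrow> real \<Rightarrow> (real \<times> real) set" where
  "dom_P W \<rho> \<gamma> p = {(x, y) \<in> unit_square. x \<le> p / \<gamma> \<and> y \<le> W \<rho>}"

definition dom_Q :: "(real \<Rightarrow> real) \<Rightarrow> real \<Rightarrow> real \<Rightarrow> real \<Rightarrow> (real \<times> real) set" where
  "dom_Q W \<rho> \<gamma> p =
     {(x, y) \<in> unit_square. x \<ge> p / \<gamma> + 1 - 1 / \<gamma> \<and> y \<ge> right_branch W \<rho> \<rho>}"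

text \<open>The two maps below are meaningful on \<^const>\<open>dom_P\<close> and \<^const>\<open>dom_Q\<close> only.\<close>

definition map_F0 :: "(real \<Rightarrow> real) \<Rightarrow> real \<Rightarrow> real \<Rightarrow> real \<times> real \<Rightarrow> real \<times> real" where
  "map_F0 W \<rho> \<gamma> = (\<lambda>(x, y). (\<gamma> * x, the_inv_into {0..\<rho>} W y))"

definition map_F1 :: "(real \<Rightarrow> real) \<Rightarrow> real \<Rightarrow> real \<Rightarrow> real \<times> real \<Rightarrow> real \<times> real" where
  "map_F1 W \<rho> \<gamma> = (\<lambda>(x, y). (\<gamma> * x + 1 - \<gamma>, the_inv_into {\<rho>..1} (right_branch W \<rho>) y))"

definition masked_op ::
    "(real \<Rightarrow> real) \<Rightarrow> real \<Rightarrow> real \<Rightarrow> real \<Rightarrow> (real \<times> real) set \<Rightarrow> (real \<times> real) set" where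
  "masked_op W \<rho> \<gamma> p S =
     map_F0 W \<rho> \<gamma> ` (S \<inter> dom_P W \<rho> \<gamma> p) \<union> map_F1 W \<rho> \<gamma> ` (S \<inter> dom_Q W \<rho> \<gamma> p)"

definition unit_graph :: "(real \<Rightarrow> real) \<Rightarrow> (real \<times> real) set" where
  "unit_graph h = {(x, h x) | x. x \<in> {0..1}}"

definition nonempty_compacts :: "'a::metric_space set \<Rightarrow> 'a set set" where
  "nonempty_compacts X = {S. S \<subseteq> X \<and> compact S \<and> S \<noteq> {}}"

definition hausdorff_dist :: "'a::metric_space set \<Rightarrow> 'a set \<Rightarrow> real" where
  "hausdorff_dist A B = max (SUP a\<in>A. infdist a B) (SUP b\<in>B. infdist b A)"

definition hausdorff_limit ::
    "'a::metric_space set \<Rightarrow> (nat \<Rightarrow> 'a set) \<Rightarrow> 'a set \<Rightarrow> bool" where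
  "hausdorff_limit X A B \<longleftrightarrow>
     (\<forall>k. A k \<in> nonempty_compacts X) \<and> B \<in> nonempty_compacts X \<and>
     (\<lambda>k. hausdorff_dist (A k) B) \<longlonglongrightarrow> 0"

end

theory Submission
  imports Defs
begin

text \<open>
  Write \<open>h\<close> for the inverse of \<open>H\<close>.  Splitting off the first symbol of an itinerary gives
  \<open>h x = \<gamma> h(W x)\<close> on \<open>[0,\<rho>]\<close> and \<open>h x = 1 - \<gamma> + \<gamma> h(W x)\<close> on \<open>(\<rho>,1]\<close>.  Hence in the coordinates
  \<open>(x, h y)\<close> both maps \<open>F\<^sub>0\<close> and \<open>F\<^sub>1\<close> act on the two coordinates by the same affine contraction.
  So the graph of \<open>H\<close>, which is the diagonal \<open>x = h y\<close>, is invariant under \<open>r\<close>, while each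
  application of \<open>r\<close> shrinks \<open>\<bar>h y - x\<bar>\<close> by the factor \<open>\<gamma>\<close>.
\<close>

section \<open>Values of itineraries under the shift\<close>

lemma seq_val_shift:
  assumes "\<And>k. \<bar>\<sigma> k\<bar> \<le> 1" "0 < \<zeta>" "\<zeta> < 1"
  shows "seq_val \<sigma> \<zeta> = (1 - \<zeta>) * \<sigma> 0 + \<zeta> * seq_val (\<lambda>k. \<sigma> (Suc k)) \<zeta>"
proof -
  \<comment> \<open>Applied both to \<sigma> and to its shift, hence stated for an arbitrary bounded
    sequence.\<close>
  have sm: "summable (\<lambda>k. \<tau> k * \<zeta> ^ k)" if "\<And>k. \<bar>\<tau> k\<bar> \<le> 1" for \<tau>
  proof (rule summable_comparison_test')
    show "summable (\<lambda>k. \<zeta> ^ k)" using assms by (simp add: summable_geometric)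
    show "norm (\<tau> k * \<zeta> ^ k) \<le> \<zeta> ^ k" if "k \<ge> 0" for k
      using assms \<open>\<And>k. \<bar>\<tau> k\<bar> \<le> 1\<close>[of k] mult_right_mono[of "\<bar>\<tau> k\<bar>" 1 "\<zeta> ^ k"]
      by (simp add: abs_mult)
  qed
  have "(\<Sum>k. \<sigma> k * \<zeta> ^ k) = (\<Sum>k. \<sigma> (Suc k) * \<zeta> ^ Suc k) + \<sigma> 0"
    using suminf_split_head[OF sm, of \<sigma>] assms(1) by simp
  also have "(\<Sum>k. \<sigma> (Suc k) * \<zeta> ^ Suc k) = (\<Sum>k. \<zeta> * (\<sigma> (Suc k) * \<zeta> ^ k))"
    by (simp add: mult_ac)
  also have "\<dots> = \<zeta> * (\<Sum>k. \<sigma> (Suc k) * \<zeta> ^ k)"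
    using assms(1) by (intro suminf_mult sm)
  finally show ?thesis unfolding seq_val_def by (simp add: algebra_simps)
qed

lemma itinerary_Suc: "itinerary W \<rho> x (Suc k) = itinerary W \<rho> (W x) k"
  by (simp add: itinerary_def funpow_swap1)

lemma seq_val_itinerary:
  assumes "0 < \<gamma>" "\<gamma> < 1"
  shows "seq_val (itinerary W \<rho> x) \<gamma> =
    (if x \<in> {0..\<rho>} then 0 else 1 - \<gamma>) + \<gamma> * seq_val (itinerary W \<rho> (W x)) \<gamma>"
proof -
  have "\<bar>itinerary W \<rho> x k\<bar> \<le> 1" for k
    by (simp add: itinerary_def)
  then have "seq_val (itinerary W \<rho> x) \<gamma> =
      (1 - \<gamma>) * itinerary W \<rho> x 0 + \<gamma> * seq_val (\<lambda>k. itinerary W \<rho> x (Suc k)) \<gamma>"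
    using assms by (rule seq_val_shift)
  moreover have "itinerary W \<rho> x 0 = (if x \<in> {0..\<rho>} then 0 else 1)"
    by (simp add: itinerary_def)
  ultimately show ?thesis
    unfolding itinerary_Suc by simp
qed

text \<open>At the fixed point 1, which carries the symbol 1, the recursion reads s = 1 - \<gamma> +
  \<gamma> s and forces s = 1, the value that \<open>conj_inv\<close> prescribes there. So the
  recursion for itineraries carries over to \<open>conj_inv\<close> at every point.\<close>

lemma conj_inv_eq_seq_val:
  assumes "0 < \<gamma>" "\<gamma> < 1" "\<rho> < 1" "W 1 = 1"
  shows "conj_inv W \<rho> \<gamma> x = seq_val (itinerary W \<rho> x) \<gamma>"
proof -
  have "(1 - \<gamma>) * seq_val (itinerary W \<rho> 1) \<gamma> = 1 - \<gamma>"
    using seq_val_itinerary[of \<gamma> W \<rho> 1] assms by (simp add: algebra_simps)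
  then show ?thesis using assms by (simp add: conj_inv_def)
qed

text \<open>A continuous injection on an interval is strictly monotone, and \<open>h 0 = 0\<close>
  together with values in [0,1] excludes the decreasing case.\<close>

lemma strict_mono_on_of_homeomorphism:
  fixes h :: "real \<Rightarrow> real"
  assumes "homeomorphism {0..1} {0..1} H h" "h 0 = 0"
  shows "strict_mono_on {0..1} h"
proof (rule strict_mono_onI)
  fix x y :: real assume xy: "x \<in> {0..1}" "y \<in> {0..1}" "x < y"
  have ran: "h z \<in> {0..1}" if "z \<in> {0..1}" for z
    using homeomorphism_image2[OF assms(1)] that by blast
  have inj: "inj_on h {0..1}"
    using homeomorphism_apply2[OF assms(1)] by (rule inj_on_inverseI)
  show "h x < h y"
  proof (cases "x = 0")
    case True
    then have "h y \<noteq> h x" using inj xy by (metis inj_onD less_irrefl)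
    with True assms(2) ran[OF xy(2)] show ?thesis by auto
  next
    case False
    have "{0..y} \<subseteq> {0..1}" using xy by auto
    then have "continuous_on {0..y} h" "inj_on h {0..y}"
      using homeomorphism_cont2[OF assms(1)] inj continuous_on_subset inj_on_subset by blast+
    \<comment> \<open>The dichotomy requires a point strictly between 0 and \<open>y\<close>, which
      is why \<open>x = 0\<close> was split off.\<close>
    then have "h 0 < h x \<and> h x < h y \<or> h y < h x \<and> h x < h 0"
      using False xy continuous_inj_imp_mono[of 0 x y h] by auto
    then show ?thesis using assms(2) ran[OF xy(1)] by auto
  qed
qed

text \<open>A real supremum is controlled only for a nonempty set that is bounded above. So the
  bound \<open>c\<close> already enters the proof of nonnegativity.\<close>

lemma hausdorff_dist_bounds:
  assumes "A \<noteq> {}" "B \<noteq> {}"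
    and "\<And>a. a \<in> A \<Longrightarrow> \<exists>b\<in>B. dist a b \<le> c"
    and "\<And>b. b \<in> B \<Longrightarrow> \<exists>a\<in>A. dist b a \<le> c"
  shows "0 \<le> hausdorff_dist A B" and "hausdorff_dist A B \<le> c"
proof -
  have AB: "infdist a B \<le> c" if "a \<in> A" for a
    using assms(3)[OF that] infdist_le order_trans by blast
  have BA: "infdist b A \<le> c" if "b \<in> B" for b
    using assms(4)[OF that] infdist_le order_trans by blast
  obtain a where a: "a \<in> A" using assms(1) by blast
  have "0 \<le> infdist a B" by (rule infdist_nonneg)
  also have "\<dots> \<le> (SUP a\<in>A. infdist a B)"
    using a AB by (intro cSUP_upper bdd_aboveI2[where M = c]) auto
  finally show "0 \<le> hausdorff_dist A B" unfolding hausdorff_dist_def by simp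
  show "hausdorff_dist A B \<le> c"
    unfolding hausdorff_dist_def using assms(1,2) AB BA by (simp add: cSUP_least)
qed

text \<open>From here on itineraries enter only through the two functional equations. The second one
  stops short of \<rho>, where \<open>W\<close> follows its left branch;
  \<open>h_right_branch\<close> extends it to \<rho> for the right branch.\<close>

locale affine_conjugacy =
  fixes W H h :: "real \<Rightarrow> real" and \<rho> \<gamma> :: real
  assumes \<rho>: "0 < \<rho>" "\<rho> < 1" and \<gamma>: "0 < \<gamma>" "\<gamma> < 1"
    and W_unit: "x \<in> {0..1} \<Longrightarrow> W x \<in> {0..1}"
    and homeo: "homeomorphism {0..1} {0..1} H h"
    and h_mono: "strict_mono_on {0..1} h"
    and h_left: "x \<in> {0..\<rho>} \<Longrightarrow> h x = \<gamma> * h (W x)"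
    and h_right: "x \<in> {\<rho><..1} \<Longrightarrow> h x = 1 - \<gamma> + \<gamma> * h (W x)"
begin

abbreviation "p \<equiv> h \<rho>"
abbreviation "P \<equiv> dom_P W \<rho> \<gamma> p"
abbreviation "Q \<equiv> dom_Q W \<rho> \<gamma> p"
abbreviation "r \<equiv> masked_op W \<rho> \<gamma> p"

section \<open>The two branches of \<open>W\<close> in the coordinate given by
  \<open>h\<close>\<close>

lemma h_unit: "x \<in> {0..1} \<Longrightarrow> h x \<in> {0..1}"
  and H_unit: "x \<in> {0..1} \<Longrightarrow> H x \<in> {0..1}"
  and H_h: "x \<in> {0..1} \<Longrightarrow> H (h x) = x"
  and h_H: "x \<in> {0..1} \<Longrightarrow> h (H x) = x"
  and cont_h: "continuous_on {0..1} h"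
  and cont_H: "continuous_on {0..1} H"
  using homeomorphism_image1[OF homeo] homeomorphism_image2[OF homeo]
    homeomorphism_apply1[OF homeo] homeomorphism_apply2[OF homeo]
    homeomorphism_cont1[OF homeo] homeomorphism_cont2[OF homeo]
  by (blast, blast, simp_all)

lemma h_le_iff: "x \<in> {0..1} \<Longrightarrow> y \<in> {0..1} \<Longrightarrow> h x \<le> h y \<longleftrightarrow> x \<le> y"
  using h_mono by (rule strict_mono_on_less_eq)

lemma rho_unit: "\<rho> \<in> {0..1}"
  using \<rho> by simp

text \<open>In the coordinates (x, h y) the two upper bounds that define \<open>P\<close> thus
  become the same number.\<close>

lemma p_left: "p / \<gamma> = h (W \<rho>)"
  using h_left[of \<rho>] \<rho> \<gamma> by simp

text \<open>To the right of \<rho>, \<open>W\<close> is \<open>H\<close> composed with the affine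
  expression \<open>?g\<close> in \<open>h\<close>. That expression is continuous up to \<rho>, so
  the one-sided limit of \<open>W\<close> exists.\<close>

lemma right_end_unit: "p / \<gamma> + 1 - 1 / \<gamma> \<in> {0..1}"
  and W_tendsto: "(W \<longlongrightarrow> H (p / \<gamma> + 1 - 1 / \<gamma>)) (at_right \<rho>)"
proof -
  let ?g = "\<lambda>x. h x / \<gamma> + 1 - 1 / \<gamma>"
  have ev: "\<forall>\<^sub>F x in at_right \<rho>. x \<in> {\<rho><..<1}"
    using \<rho> eventually_at_right_real by blast
  have g: "?g x = h (W x)" if "x \<in> {\<rho><..1}" for x
    using h_right[OF that] \<gamma> by (simp add: field_simps)
  have g_unit: "?g x \<in> {0..1}" if "x \<in> {\<rho><..<1}" for x
    using g[of x] h_unit[OF W_unit, of x] that \<rho> by auto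
  have "(h \<longlongrightarrow> h \<rho>) (at \<rho> within {0..1})"
    using cont_h rho_unit by (simp add: continuous_on_def)
  then have "(h \<longlongrightarrow> h \<rho>) (at \<rho> within {\<rho>..1})"
    by (rule tendsto_within_subset) (use \<rho> in auto)
  then have "(h \<longlongrightarrow> h \<rho>) (at_right \<rho>)"
    using at_within_Icc_at_right[OF \<rho>(2)] by simp
  then have lim: "(?g \<longlongrightarrow> ?g \<rho>) (at_right \<rho>)"
    using \<gamma> by (intro tendsto_intros) auto
  \<comment> \<open>\<open>H\<close> is known to be continuous on [0,1] only, so the limit point
    must be placed there before \<open>H\<close> is applied; closedness of [0,1] does this.\<close>
  show unit: "?g \<rho> \<in> {0..1}"
    by (rule Lim_in_closed_set[OF _ _ _ lim]) (use ev g_unit in \<open>auto elim!: eventually_mono\<close>)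
  have "((\<lambda>x. H (?g x)) \<longlongrightarrow> H (?g \<rho>)) (at_right \<rho>)"
    by (rule continuous_on_tendsto_compose[OF cont_H lim unit])
      (use ev g_unit in \<open>auto elim!: eventually_mono\<close>)
  then show "(W \<longlongrightarrow> H (p / \<gamma> + 1 - 1 / \<gamma>)) (at_right \<rho>)"
  proof (rule Lim_transform_eventually)
    show "\<forall>\<^sub>F x in at_right \<rho>. H (?g x) = W x"
      using ev by eventually_elim (use g H_h W_unit \<rho> in auto)
  qed
qed

text \<open>\<open>Lim\<close> is a definite description and gets its value from the convergence
  just shown. This is the counterpart of \<open>p_left\<close>: the two lower bounds that define
  \<open>Q\<close> agree in the coordinates (x, h y).\<close>

lemma right_branch_rho: "right_branch W \<rho> \<rho> = H (p / \<gamma> + 1 - 1 / \<gamma>)"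
  unfolding right_branch_def using W_tendsto by (simp add: tendsto_Lim)

lemma right_branch_unit: "x \<in> {\<rho>..1} \<Longrightarrow> right_branch W \<rho> x \<in> {0..1}"
  using right_branch_rho H_unit[OF right_end_unit] W_unit[of x] \<rho>
  by (cases "x = \<rho>") (auto simp: right_branch_def)

lemma h_right_branch:
  assumes "x \<in> {\<rho>..1}"
  shows "h x = 1 - \<gamma> + \<gamma> * h (right_branch W \<rho> x)"
proof (cases "x = \<rho>")
  case True
  have "h (right_branch W \<rho> \<rho>) = p / \<gamma> + 1 - 1 / \<gamma>"
    using right_branch_rho h_H[OF right_end_unit] by simp
  then have "\<gamma> * h (right_branch W \<rho> \<rho>) = \<gamma> * (p / \<gamma> + 1 - 1 / \<gamma>)" by simp
  also have "\<dots> = p + \<gamma> - 1" using \<gamma> by (simp add: algebra_simps)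
  finally show ?thesis using True by simp
next
  case False
  then show ?thesis using h_right[of x] assms by (simp add: right_branch_def)
qed

text \<open>Solving h x = \<gamma> h(W x) under W x = y leaves H(\<gamma> h y) as the only
  candidate. The bound \<open>y \<le> W \<rho>\<close> places it in [0,\<rho>], where the equation
  holds. There h x depends on W x alone, so \<open>W\<close> is injective and
  \<open>the_inv_into\<close> selects the candidate.\<close>

lemma W_inverse:
  assumes "y \<in> {0..1}" "y \<le> W \<rho>"
  shows "the_inv_into {0..\<rho>} W y = H (\<gamma> * h y)"
proof -
  have "h y \<le> h (W \<rho>)" using assms h_le_iff W_unit[OF rho_unit] by blast
  then have le: "\<gamma> * h y \<le> h \<rho>" using p_left \<gamma> by (simp add: field_simps)
  have u: "\<gamma> * h y \<in> {0..1}"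
    using h_unit[OF assms(1)] \<gamma> by (auto simp: mult_le_one)
  have x: "H (\<gamma> * h y) \<in> {0..\<rho>}"
    using h_le_iff[OF H_unit[OF u] rho_unit] h_H[OF u] le H_unit[OF u] by auto
  then have "\<gamma> * h (W (H (\<gamma> * h y))) = \<gamma> * h y"
    using h_left[OF x] h_H[OF u] by linarith
  then have "h (W (H (\<gamma> * h y))) = h y" using \<gamma> by simp
  then have "W (H (\<gamma> * h y)) = y"
    using H_h[OF assms(1)] H_h[OF W_unit[OF H_unit[OF u]]] by simp
  moreover have "inj_on W {0..\<rho>}"
  proof (rule inj_onI)
    fix a b assume ab: "a \<in> {0..\<rho>}" "b \<in> {0..\<rho>}" and eq: "W a = W b"
    have "a \<in> {0..1}" "b \<in> {0..1}" using ab \<rho> by auto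
    moreover have "h a = h b" unfolding h_left[OF ab(1)] h_left[OF ab(2)] eq ..
    ultimately show "a = b" using H_h by metis
  qed
  ultimately show "the_inv_into {0..\<rho>} W y = H (\<gamma> * h y)"
    using x by (metis the_inv_into_f_eq)
qed

text \<open>The argument is that of \<open>W_inverse\<close>, with the equation on the closed
  interval: for \<open>y\<close> equal to the value of the right branch at \<rho>, the preimage is
  \<rho> itself.\<close>

lemma right_branch_inverse:
  assumes "y \<in> {0..1}" "right_branch W \<rho> \<rho> \<le> y"
  shows "the_inv_into {\<rho>..1} (right_branch W \<rho>) y = H (\<gamma> * h y + 1 - \<gamma>)"
proof -
  let ?R = "right_branch W \<rho>" and ?u = "\<gamma> * h y + 1 - \<gamma>"
  have "h (?R \<rho>) \<le> h y" using assms h_le_iff right_branch_unit[of \<rho>] \<rho> by auto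
  then have le: "h \<rho> \<le> ?u"
    using h_right_branch[of \<rho>] \<gamma> \<rho> by (simp add: mult_left_mono)
  have "0 \<le> \<gamma> * h y" "\<gamma> * h y \<le> \<gamma> * 1"
    using h_unit[OF assms(1)] \<gamma> by (auto intro: mult_left_mono)
  then have u: "?u \<in> {0..1}" using \<gamma> unfolding atLeastAtMost_iff by linarith
  have x: "H ?u \<in> {\<rho>..1}"
    using h_le_iff[OF rho_unit H_unit[OF u]] h_H[OF u] le H_unit[OF u] by auto
  then have "\<gamma> * h (?R (H ?u)) = \<gamma> * h y"
    using h_right_branch[OF x] h_H[OF u] by linarith
  then have "h (?R (H ?u)) = h y" using \<gamma> by simp
  then have "?R (H ?u) = y"
    using H_h[OF assms(1)] H_h[OF right_branch_unit[OF x]] by simp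
  moreover have "inj_on ?R {\<rho>..1}"
  proof (rule inj_onI)
    fix a b assume ab: "a \<in> {\<rho>..1}" "b \<in> {\<rho>..1}" and eq: "?R a = ?R b"
    have "a \<in> {0..1}" "b \<in> {0..1}" using ab \<rho> by auto
    moreover have "h a = h b" unfolding h_right_branch[OF ab(1)] h_right_branch[OF ab(2)] eq ..
    ultimately show "a = b" using H_h by metis
  qed
  ultimately show "the_inv_into {\<rho>..1} ?R y = H ?u"
    using x by (metis the_inv_into_f_eq)
qed

section \<open>The maps and the operator in the coordinates (x, h y)\<close>

lemma map_F0_eq: "(x, y) \<in> P \<Longrightarrow> map_F0 W \<rho> \<gamma> (x, y) = (\<gamma> * x, H (\<gamma> * h y))"
  using W_inverse[of y] by (auto simp: dom_P_def unit_square_def map_F0_def)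

lemma map_F1_eq:
  "(x, y) \<in> Q \<Longrightarrow> map_F1 W \<rho> \<gamma> (x, y) = (\<gamma> * x + 1 - \<gamma>, H (\<gamma> * h y + 1 - \<gamma>))"
  using right_branch_inverse[of y] by (auto simp: dom_Q_def unit_square_def map_F1_def)

text \<open>\<open>h\<close> and \<open>H\<close> are inverse to each other on [0,1] only, so
  cancelling them after a step requires that both affine contractions keep their arguments in
  [0,1].\<close>

lemma h_unit_scaled:
  assumes "(x, y) \<in> unit_square"
  shows "\<gamma> * x \<in> {0..1}" "\<gamma> * x + 1 - \<gamma> \<in> {0..1}"
    and "\<gamma> * h y \<in> {0..1}" "\<gamma> * h y + 1 - \<gamma> \<in> {0..1}"
proof -
  have scale: "\<gamma> * t \<in> {0..1} \<and> \<gamma> * t + 1 - \<gamma> \<in> {0..1}" if "t \<in> {0..1}" for t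
    
  proof -
    have "0 \<le> \<gamma> * t" "\<gamma> * t \<le> \<gamma> * 1" using that \<gamma> by (auto intro: mult_left_mono)
    then show ?thesis using \<gamma> unfolding atLeastAtMost_iff by linarith
  qed
  show "\<gamma> * x \<in> {0..1}" "\<gamma> * x + 1 - \<gamma> \<in> {0..1}"
    and "\<gamma> * h y \<in> {0..1}" "\<gamma> * h y + 1 - \<gamma> \<in> {0..1}"
    using scale[of x] scale[of "h y"] h_unit[of y] assms
    unfolding unit_square_def mem_Times_iff fst_conv snd_conv by blast+
qed

lemma masked_op_cases:
  assumes "q \<in> r S"
  obtains x y where "(x, y) \<in> S" "(x, y) \<in> P" "q = (\<gamma> * x, H (\<gamma> * h y))"
  | x y where "(x, y) \<in> S" "(x, y) \<in> Q" "q = (\<gamma> * x + 1 - \<gamma>, H (\<gamma> * h y + 1 - \<gamma>))"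
proof -
  from assms consider "q \<in> map_F0 W \<rho> \<gamma> ` (S \<inter> P)" | "q \<in> map_F1 W \<rho> \<gamma> ` (S \<inter> Q)"
    unfolding masked_op_def by blast
  then show thesis
  proof cases
    case 1
    then obtain x y where "(x, y) \<in> S" "(x, y) \<in> P" "q = map_F0 W \<rho> \<gamma> (x, y)"
      by auto
    then show thesis using that(1) map_F0_eq by simp
  next
    case 2
    then obtain x y where "(x, y) \<in> S" "(x, y) \<in> Q" "q = map_F1 W \<rho> \<gamma> (x, y)"
      by auto
    then show thesis using that(2) map_F1_eq by simp
  qed
qed

lemma dom_unit: "P \<subseteq> unit_square" "Q \<subseteq> unit_square"
  unfolding dom_P_def dom_Q_def by auto

lemma masked_op_subset: "r S \<subseteq> unit_square"
proof
  fix q assume "q \<in> r S"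
  then show "q \<in> unit_square"
  proof (cases rule: masked_op_cases)
    case (1 x y)
    then show ?thesis using h_unit_scaled[of x y] H_unit[of "\<gamma> * h y"] dom_unit
      by (auto simp: unit_square_def)
  next
    case (2 x y)
    then show ?thesis using h_unit_scaled[of x y] H_unit[of "\<gamma> * h y + 1 - \<gamma>"] dom_unit
      by (auto simp: unit_square_def)
  qed
qed

lemma iter_subset: "(r ^^ k) unit_square \<subseteq> unit_square"
  by (cases k) (simp_all add: masked_op_subset)

section \<open>Invariance of the graph and contraction towards it\<close>

lemma graph_iff: "(x, y) \<in> unit_graph H \<longleftrightarrow> y \<in> {0..1} \<and> x = h y"
proof
  assume "(x, y) \<in> unit_graph H"
  then have "x \<in> {0..1}" "y = H x" unfolding unit_graph_def by auto
  then show "y \<in> {0..1} \<and> x = h y" using h_H[of x] H_unit[of x] by simp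
next
  assume "y \<in> {0..1} \<and> x = h y"
  then have "x \<in> {0..1}" "y = H x" using H_h[of y] h_unit[of y] by auto
  then show "(x, y) \<in> unit_graph H" unfolding unit_graph_def by blast
qed

lemma graph_subset: "unit_graph H \<subseteq> unit_square"
proof
  fix q assume "q \<in> unit_graph H"
  then obtain x where "x \<in> {0..1}" "q = (x, H x)" unfolding unit_graph_def by blast
  then show "q \<in> unit_square" using H_unit[of x] by (simp add: unit_square_def)
qed

text \<open>A graph point (h y, y) is the image of the graph point whose second coordinate is the
  image of \<open>y\<close> under the branch of \<open>W\<close> at \<open>y\<close>; monotonicity
  of \<open>h\<close> puts that preimage into \<open>P\<close> or \<open>Q\<close>. Allowing any
  \<open>S\<close> that contains the graph lets the inclusion be iterated from the square.\<close>

lemma graph_subset_masked_op: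
  assumes "unit_graph H \<subseteq> S"
  shows "unit_graph H \<subseteq> r S"
proof (rule subrelI)
  fix x y assume "(x, y) \<in> unit_graph H"
  then have y: "y \<in> {0..1}" and x: "x = h y" using graph_iff by auto
  show "(x, y) \<in> r S"
  proof (cases "y \<le> \<rho>")
    case True
    have Wy: "W y \<in> {0..1}" using W_unit y .
    have hy: "\<gamma> * h (W y) = h y" using h_left[of y] True y by simp
    have "h y \<le> h \<rho>" using h_le_iff y rho_unit True by blast
    then have "\<gamma> * h (W y) \<le> \<gamma> * h (W \<rho>)" using hy h_left[of \<rho>] \<rho> by simp
    \<comment> \<open>This one inequality yields both bounds of \<open>P\<close>: the first through
      \<open>p_left\<close>, the second through \<open>h_le_iff\<close>.\<close>
    then have le: "h (W y) \<le> h (W \<rho>)" using \<gamma> by simp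
    then have "W y \<le> W \<rho>" using h_le_iff[OF Wy W_unit[OF rho_unit]] by simp
    then have "(h (W y), W y) \<in> P"
      using le Wy h_unit[OF Wy] p_left by (simp add: dom_P_def unit_square_def)
    moreover from this have "map_F0 W \<rho> \<gamma> (h (W y), W y) = (x, y)"
      using map_F0_eq[of "h (W y)" "W y"] hy H_h[OF y] x by simp
    moreover have "(h (W y), W y) \<in> S" using assms graph_iff Wy by blast
    ultimately show ?thesis unfolding masked_op_def by (metis IntI UnI1 image_eqI)
  next
    case False
    \<comment> \<open>Here \<open>?z\<close> is just \<open>W y\<close>; writing it with
      \<open>right_branch\<close> allows one equation to serve both \<open>y\<close> and the
      comparison point \<rho>.\<close>
    let ?z = "right_branch W \<rho> y"
    have y': "y \<in> {\<rho>..1}" and r': "\<rho> \<in> {\<rho>..1}" using False y \<rho> by auto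
    have z: "?z \<in> {0..1}" using right_branch_unit y' .
    have hy: "\<gamma> * h ?z + 1 - \<gamma> = h y" using h_right_branch[OF y'] by linarith
    have "h \<rho> \<le> h y" using h_le_iff y rho_unit False by auto
    then have "\<gamma> * h (right_branch W \<rho> \<rho>) \<le> \<gamma> * h ?z"
      using hy h_right_branch[OF r'] by simp
    then have le: "h (right_branch W \<rho> \<rho>) \<le> h ?z" using \<gamma> by simp
    then have "right_branch W \<rho> \<rho> \<le> ?z"
      using h_le_iff[OF right_branch_unit[OF r'] z] by simp
    then have "(h ?z, ?z) \<in> Q"
      using le z h_unit[OF z] right_branch_rho h_H[OF right_end_unit]
      by (simp add: dom_Q_def unit_square_def)
    moreover from this have "map_F1 W \<rho> \<gamma> (h ?z, ?z) = (x, y)"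
      using map_F1_eq[of "h ?z" ?z] hy H_h[OF y] x by simp
    moreover have "(h ?z, ?z) \<in> S" using assms graph_iff z by blast
    ultimately show ?thesis unfolding masked_op_def by (metis IntI UnI2 image_eqI)
  qed
qed

lemma graph_subset_iter: "unit_graph H \<subseteq> (r ^^ k) unit_square"
  by (induction k) (simp_all add: graph_subset graph_subset_masked_op)

text \<open>The translation part cancels in the difference of the two coordinates and the factor
  \<gamma> remains; on the square the difference is at most 1. The deviation is measured
  horizontally because the contraction rate is uniform there, while \<open>H\<close> is known only
  to be continuous.\<close>

lemma iter_deviation: "(x, y) \<in> (r ^^ k) unit_square \<Longrightarrow> \<bar>h y - x\<bar> \<le> \<gamma> ^ k"
proof (induction k arbitrary: x y)
  case 0
  then show ?case using h_unit[of y] by (auto simp: unit_square_def)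
next
  case (Suc k)
  from Suc.prems have "(x, y) \<in> r ((r ^^ k) unit_square)" by simp
  then show ?case
  proof (cases rule: masked_op_cases)
    case (1 a b)
    then have "h y = \<gamma> * h b" "x = \<gamma> * a"
      using h_H[of "\<gamma> * h b"] h_unit_scaled(3)[of a b] dom_unit by auto
    then have "h y - x = \<gamma> * (h b - a)" by (simp add: right_diff_distrib)
    then have "\<bar>h y - x\<bar> = \<gamma> * \<bar>h b - a\<bar>" using \<gamma> by (simp add: abs_mult)
    then show ?thesis using Suc.IH[OF 1(1)] \<gamma> by simp
  next
    case (2 a b)
    then have "h y = \<gamma> * h b + 1 - \<gamma>" "x = \<gamma> * a + 1 - \<gamma>"
      using h_H[of "\<gamma> * h b + 1 - \<gamma>"] h_unit_scaled(4)[of a b] dom_unit by auto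
    then have "h y - x = \<gamma> * (h b - a)" by (simp add: right_diff_distrib)
    then have "\<bar>h y - x\<bar> = \<gamma> * \<bar>h b - a\<bar>" using \<gamma> by (simp add: abs_mult)
    then show ?thesis using Suc.IH[OF 2(1)] \<gamma> by simp
  qed
qed

lemma graph_eq_Inter: "unit_graph H = (\<Inter>k. (r ^^ k) unit_square)"
proof
  show "unit_graph H \<subseteq> (\<Inter>k. (r ^^ k) unit_square)" using graph_subset_iter by blast
  show "(\<Inter>k. (r ^^ k) unit_square) \<subseteq> unit_graph H"
  proof (rule subrelI)
    fix x y assume "(x, y) \<in> (\<Inter>k. (r ^^ k) unit_square)"
    then have mem: "(x, y) \<in> (r ^^ k) unit_square" for k by blast
    have "(\<lambda>k. \<gamma> ^ k) \<longlonglongrightarrow> 0" using \<gamma> by (intro LIMSEQ_realpow_zero) auto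
    then have "\<bar>h y - x\<bar> \<le> 0"
      by (rule LIMSEQ_le_const) (use iter_deviation[OF mem] in blast)
    \<comment> \<open>The iterate with index 0 is the square itself.\<close>
    moreover have "y \<in> {0..1}" using mem[of 0] by (simp add: unit_square_def)
    ultimately show "(x, y) \<in> unit_graph H" using graph_iff by auto
  qed
qed

section \<open>Compactness of the iterates and Hausdorff convergence\<close>

lemma closed_dom: "closed P" "closed Q"
proof -
  have "P = unit_square \<inter> {..p / \<gamma>} \<times> {..W \<rho>}"
    unfolding dom_P_def by auto
  then show "closed P"
    by (simp add: unit_square_def closed_Int closed_Times)
  have "Q = unit_square \<inter> {p / \<gamma> + 1 - 1 / \<gamma>..} \<times> {right_branch W \<rho> \<rho>..}"
    unfolding dom_Q_def by auto
  then show "closed Q"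
    by (simp add: unit_square_def closed_Int closed_Times)
qed

text \<open>Continuity of the inverse branches is read off from their formulas in \<open>h\<close>
  and \<open>H\<close>. These are continuous on the whole square and represent the maps on
  \<open>P\<close> and \<open>Q\<close>.\<close>

lemma continuous_on_maps:
  "continuous_on P (map_F0 W \<rho> \<gamma>)" "continuous_on Q (map_F1 W \<rho> \<gamma>)"
proof -
  have hs: "continuous_on unit_square (\<lambda>q. h (snd q))"
    by (intro continuous_on_compose2[OF cont_h] continuous_intros) (auto simp: unit_square_def)
  have "continuous_on unit_square (\<lambda>q. (\<gamma> * fst q, H (\<gamma> * h (snd q))))"
    by (intro continuous_intros continuous_on_compose2[OF cont_H] hs)
      (use h_unit_scaled(3) in auto)
  then have "continuous_on P (\<lambda>q. (\<gamma> * fst q, H (\<gamma> * h (snd q))))"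
    using dom_unit(1) by (rule continuous_on_subset)
  then show "continuous_on P (map_F0 W \<rho> \<gamma>)"
    by (rule continuous_on_eq) (use map_F0_eq in auto)
  have "continuous_on unit_square (\<lambda>q. (\<gamma> * fst q + 1 - \<gamma>, H (\<gamma> * h (snd q) + 1 - \<gamma>)))"
    by (intro continuous_intros continuous_on_compose2[OF cont_H] hs)
      (use h_unit_scaled(4) in auto)
  then have "continuous_on Q (\<lambda>q. (\<gamma> * fst q + 1 - \<gamma>, H (\<gamma> * h (snd q) + 1 - \<gamma>)))"
    using dom_unit(2) by (rule continuous_on_subset)
  then show "continuous_on Q (map_F1 W \<rho> \<gamma>)"
    by (rule continuous_on_eq) (use map_F1_eq in auto)
qed

lemma compact_masked_op: "compact S \<Longrightarrow> compact (r S)"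
  unfolding masked_op_def using closed_dom continuous_on_maps
  by (intro compact_Un compact_continuous_image compact_Int_closed)
    (auto intro: continuous_on_subset)

lemma compact_iter: "compact ((r ^^ k) unit_square)"
  by (induction k) (simp_all add: compact_masked_op unit_square_def compact_Times)

lemma graph_nonempty_compact: "unit_graph H \<in> nonempty_compacts unit_square"
proof -
  have eq: "unit_graph H = (\<lambda>x. (x, H x)) ` {0..1}" unfolding unit_graph_def by auto
  have "compact (unit_graph H)"
    unfolding eq by (intro compact_continuous_image continuous_intros cont_H) auto
  then show ?thesis
    using graph_subset eq by (simp add: nonempty_compacts_def)
qed

lemma iter_hausdorff_limit:
  "hausdorff_limit unit_square (\<lambda>k. (r ^^ k) unit_square) (unit_graph H)"
proof -
  have ne: "unit_graph H \<noteq> {}"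
    using graph_nonempty_compact by (simp add: nonempty_compacts_def)
  then have ne': "(r ^^ k) unit_square \<noteq> {}" for k using graph_subset_iter[of k] by blast
  have near: "\<exists>b\<in>unit_graph H. dist a b \<le> \<gamma> ^ k" if "a \<in> (r ^^ k) unit_square" for a k
  proof -
    obtain x y where a: "a = (x, y)" by (cases a)
    have "y \<in> {0..1}" using that iter_subset[of k] by (auto simp: a unit_square_def)
    \<comment> \<open>The nearby graph point is taken on the same horizontal line, so its distance
      is exactly the deviation.\<close>
    then have "(h y, y) \<in> unit_graph H" using graph_iff by simp
    moreover have "dist a (h y, y) \<le> \<gamma> ^ k"
      using iter_deviation[of x y k] that
      by (simp add: a dist_Pair_Pair dist_real_def abs_minus_commute)
    ultimately show ?thesis by blast
  qed
  \<comment> \<open>Each iterate contains the graph, so \<open>b\<close> itself is a witness at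
    distance 0.\<close>
  have near': "\<exists>a\<in>(r ^^ k) unit_square. dist b a \<le> \<gamma> ^ k" if "b \<in> unit_graph H" for b k
    using that graph_subset_iter[of k] \<gamma> by (intro bexI[of _ b]) auto
  note bounds = hausdorff_dist_bounds[OF ne' ne near near']
  have "(\<lambda>k. hausdorff_dist ((r ^^ k) unit_square) (unit_graph H)) \<longlonglongrightarrow> 0"
    by (rule tendsto_sandwich[where f = "\<lambda>_. 0" and h = "\<lambda>k. \<gamma> ^ k"])
      (use bounds \<gamma> in \<open>auto intro: LIMSEQ_realpow_zero\<close>)
  then show ?thesis
    unfolding hausdorff_limit_def
    using graph_nonempty_compact compact_iter iter_subset ne'
    by (simp add: nonempty_compacts_def)
qed

end

theorem theorem2:
  fixes W H :: "real \<Rightarrow> real" and lam \<rho> \<gamma> p :: real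
  assumes "0 < lam" "lam < 1" and "0 < \<rho>" "\<rho> < 1"
    and "W \<in> {0..1} \<rightarrow> {0..1}" and "W 0 = 0" and "W 1 = 1"
    and "\<And>x. x \<in> {0..\<rho>} \<Longrightarrow>
           \<exists>D > 1 / lam. (W has_real_derivative D) (at x within {0..\<rho>})"
    and "\<And>x. x \<in> {\<rho><..1} \<Longrightarrow>
           \<exists>D > 1 / lam. (W has_real_derivative D) (at x within {\<rho><..1})"
    and "is_critical_param W \<rho> \<gamma>"
    and "p = seq_val (itinerary W \<rho> \<rho>) \<gamma>"
    and "homeomorphism {0..1} {0..1} H (conj_inv W \<rho> \<gamma>)"
    and "\<And>x. x \<in> {0..1} \<Longrightarrow> W x = H (lin_map \<gamma> p (conj_inv W \<rho> \<gamma> x))"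
  shows "unit_graph H = (\<Inter>k. (masked_op W \<rho> \<gamma> p ^^ k) unit_square) \<and>
         hausdorff_limit unit_square (\<lambda>k. (masked_op W \<rho> \<gamma> p ^^ k) unit_square) (unit_graph H)"
proof -
  let ?h = "conj_inv W \<rho> \<gamma>"
  have \<gamma>: "0 < \<gamma>" "\<gamma> < 1" using assms(10) by (auto simp: is_critical_param_def)
  have h: "?h x = seq_val (itinerary W \<rho> x) \<gamma>" for x
    using conj_inv_eq_seq_val \<gamma> assms by blast
  have step: "?h x = (if x \<in> {0..\<rho>} then 0 else 1 - \<gamma>) + \<gamma> * ?h (W x)" for x
    unfolding h using seq_val_itinerary \<gamma> .
  \<comment> \<open>0 is a fixed point with symbol 0, so the recursion reads s = \<gamma> s. The
    resulting value makes \<open>?h\<close> increasing.\<close>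
  have "(1 - \<gamma>) * ?h 0 = 0"
    using step[of 0] assms(3,6) by (simp add: algebra_simps)
  then have "?h 0 = 0" using \<gamma> by simp
  then interpret affine_conjugacy W H ?h \<rho> \<gamma>
  proof unfold_locales
    show "strict_mono_on {0..1} ?h"
      using assms(12) \<open>?h 0 = 0\<close> by (rule strict_mono_on_of_homeomorphism)
    show "?h x = \<gamma> * ?h (W x)" if "x \<in> {0..\<rho>}" for x using step[of x] that by simp
    show "?h x = 1 - \<gamma> + \<gamma> * ?h (W x)" if "x \<in> {\<rho><..1}" for x using step[of x] that by simp
    show "W x \<in> {0..1}" if "x \<in> {0..1}" for x using assms(5) that by (rule funcset_mem)
  qed (use assms(3,4,12) \<gamma> in auto)
  \<comment> \<open>Identifies the given \<open>p\<close> with the value at \<rho> that the locale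
    abbreviates by the same letter.\<close>
  have "p = ?h \<rho>" using assms(11) h by simp
  then show ?thesis using graph_eq_Inter iter_hausdorff_limit by simp
qed

end
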